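(* Let $n,k,\eta$ be positive integers, let $c\ge 1$, and let $\tilde{\mathcal{G}}\subseteq\mathcal{G}(n,k,c)$. Suppose that for a given distributed task and all graphs $G\in\tilde{\mathcal{G}}$ there is a randomized distributed protocol with error probability $\epsilon$ that runs in $T\le (n-2\eta)/(2k)$ rounds. Then there exists a public-coin two-party protocol that $\eta$-solves the given distributed task on all graphs $G\in\tilde{\mathcal{G}}$ with error probability $\epsilon$ and communication complexity at most $2BcT$.
   Context: Distributed model: a weighted network $G=(V,E,w)$ with $w(e)\ge 1$ for all $e$. A distributed task gives each node $v$ a private input $x(v)$ and requires each node to compute an output $y(v)$ so that inputs and outputs together satisfy a given specification. Initially each node knows its input and its set of neighbors; in each synchronous round, each node may send at most $B\cdot w(e)$ bits over each incident edge $e$. A randomized protocol solves the task with error probability $\epsilon$ if the outputs satisfy the specification with probability at least $1-\epsilon$. Graph family: $G=(V,E,w)\in\mathcal{G}(n,k,c)$ iff $V=\{0,\dots,n-1\}$ and for every $h\in\{0,\dots,n-1\}$ the total weight of edges between $\{0,\dots,h\}$ and $\{h+k+1,\dots,n-1\}$ is at most $c$. For an integer $\eta\ge1$, $L_\eta=\{0,\dots,\eta-1\}$ and $R_\eta=\{n-\eta,\dots,n-1\}$. A two-party protocol between Alice and Bob $\eta$-solves the task for $G$ with error probability $\epsilon$ if (a) initially Alice knows all inputs and initial states of nodes in $V\setminus R_\eta$ and Bob knows all inputs and initial states of nodes in $V\setminus L_\eta$, and (b) at the end Alice outputs $y(v)$ for all $v\in L_{n/2}$ and Bob outputs $y(v)$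 for all $v\in R_{n/2}$ such that, with probability at least $1-\epsilon$, all these outputs are consistent with the specification. Public coin means Alice and Bob share a common random string. Communication complexity is the total number of bits exchanged.
   Formalization: Each node's initial state (hence what Alice and Bob know) also includes the weights of its incident edges, and a message over e is read as exactly ⌊B·w(e)⌋ bits, unsent bits being 0, so its length carries no information; without these the bound 2BcT can fail. *)

theory Defs
  imports "HOL-Probability.Probability"
begin

record network =
  verts :: "nat set"
  edges :: "nat set set"
  weight :: "nat set \<Rightarrow> real"

definition wf_network :: "network \<Rightarrow> bool" where
  "wf_network G \<longleftrightarrow> finite (verts G)
     \<and> (\<forall>e\<in>edges G. e \<subseteq> verts G \<and> card e = 2)
     \<and> (\<forall>e\<in>edges G. weight G e \<ge> 1)"

definition weight_between :: "network \<Rightarrow> nat set \<Rightarrow> nat set \<Rightarrow> real" where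
  "weight_between G X Y = (\<Sum>e | e \<in> edges G \<and> (\<exists>u\<in>X. \<exists>v\<in>Y. e = {u, v}). weight G e)"

definition graph_family :: "nat \<Rightarrow> nat \<Rightarrow> real \<Rightarrow> network set" where
  "graph_family n k c = {G. wf_network G \<and> verts G = {0..<n}
     \<and> (\<forall>h\<in>{0..<n}. weight_between G {0..h} {h + k + 1..<n} \<le> c)}"

text \<open>What a node knows of the network at the start: its neighbours (the domain of the map)
  and the weights, i.e. the bandwidths, of its incident edges.\<close>

definition initial_state :: "network \<Rightarrow> nat \<Rightarrow> (nat \<rightharpoonup> real)" where
  "initial_state G v = (\<lambda>u. if {u, v} \<in> edges G then Some (weight G {u, v}) else None)"


section \<open>Distributed protocols\<close>

text \<open>A task is its specification: which outputs are correct for which inputs on a network.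
  Input and output vectors are extensional functions on the node set.\<close>

type_synonym ('x, 'y) task = "network \<Rightarrow> (nat \<Rightarrow> 'x) \<Rightarrow> (nat \<Rightarrow> 'y) \<Rightarrow> bool"

text \<open>Everything a node has seen so far: its name, input, initial state, private coin tosses, and
  for each completed round the bits received from each node. Local computation is unrestricted, so
  a protocol is given by arbitrary functions of this view; the number of the current round is the
  length of the last component.\<close>

type_synonym 'x node_view =
  "nat \<times> 'x \<times> (nat \<rightharpoonup> real) \<times> (nat \<Rightarrow> bool) \<times> (nat \<Rightarrow> bool list) list"

record ('x, 'y) dist_protocol =
  send_to :: "'x node_view \<Rightarrow> nat \<Rightarrow> bool list"
  node_output :: "'x node_view \<Rightarrow> 'y"

text \<open>The receiver at an edge of capacity \<open>b\<close> sees \<open>b\<close> bits, those that were not sent reading as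
  \<open>False\<close>. Hence the length of a message carries no information beyond its bits; otherwise
  ``at most \<open>b\<close> bits'' would admit \<open>2 ^ (b + 1) - 1\<close> distinguishable messages.\<close>

definition pad :: "nat \<Rightarrow> bool list \<Rightarrow> bool list" where
  "pad b m = m @ replicate (b - length m) False"

context
  fixes B :: real and P :: "('x, 'y) dist_protocol" and G :: network
    and x :: "nat \<Rightarrow> 'x" and \<omega> :: "nat \<times> nat \<Rightarrow> bool"
begin

text \<open>\<open>\<omega> (v, i)\<close> is the \<open>i\<close>-th private coin toss of node \<open>v\<close>.\<close>

fun received :: "nat \<Rightarrow> nat \<Rightarrow> (nat \<Rightarrow> bool list) list" where
  "received 0 v = []"
| "received (Suc t) v = received t v @
     [\<lambda>u. if {u, v} \<in> edges G
          then pad (nat \<lfloor>B * weight G {u, v}\<rfloor>)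
                 (send_to P (u, x u, initial_state G u, (\<lambda>i. \<omega> (u, i)), received t u) v)
          else []]"

definition view_after :: "nat \<Rightarrow> nat \<Rightarrow> 'x node_view" where
  "view_after t v = (v, x v, initial_state G v, (\<lambda>i. \<omega> (v, i)), received t v)"

definition dist_outputs :: "nat \<Rightarrow> nat \<Rightarrow> 'y" where
  "dist_outputs T = (\<lambda>v\<in>verts G. node_output P (view_after T v))"

end

abbreviation fair_coin :: "bool measure" where
  "fair_coin \<equiv> measure_pmf (bernoulli_pmf (1 / 2))"

definition node_coins :: "network \<Rightarrow> (nat \<times> nat \<Rightarrow> bool) measure" where
  "node_coins G = (\<Pi>\<^sub>M i\<in>verts G \<times> UNIV. fair_coin)"

definition holds_with_prob :: "'a measure \<Rightarrow> ('a \<Rightarrow> bool) \<Rightarrow> real \<Rightarrow> bool" where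
  "holds_with_prob M E p \<longleftrightarrow> {\<omega> \<in> space M. E \<omega>} \<in> sets M \<and> measure M {\<omega> \<in> space M. E \<omega>} \<ge> p"

definition respects_bandwidth ::
  "real \<Rightarrow> ('x, 'y) dist_protocol \<Rightarrow> nat \<Rightarrow> network \<Rightarrow> bool" where
  "respects_bandwidth B P T G \<longleftrightarrow>
     (\<forall>x \<in> verts G \<rightarrow>\<^sub>E UNIV. \<forall>\<omega> \<in> space (node_coins G). \<forall>t<T. \<forall>u v. {u, v} \<in> edges G \<longrightarrow>
        real (length (send_to P (view_after B P G x \<omega> t u) v)) \<le> B * weight G {u, v})"

definition dist_solves ::
  "real \<Rightarrow> ('x, 'y) dist_protocol \<Rightarrow> nat \<Rightarrow> ('x, 'y) task \<Rightarrow> real \<Rightarrow> network \<Rightarrow> bool" where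
  "dist_solves B P T task \<epsilon> G \<longleftrightarrow> respects_bandwidth B P T G
     \<and> (\<forall>x \<in> verts G \<rightarrow>\<^sub>E UNIV.
          holds_with_prob (node_coins G) (\<lambda>\<omega>. task G x (dist_outputs B P G x \<omega> T)) (1 - \<epsilon>))"


section \<open>Two-party protocols\<close>

text \<open>Protocol trees: at an inner node its owner sends one bit, computed from what the owner knows
  initially, and the protocol continues in the first (\<open>False\<close>) or second (\<open>True\<close>) subtree. At a
  leaf each party computes its output from its own initial knowledge. A public-coin protocol
  is a family of such trees indexed by the common random string.\<close>

datatype ('a, 'b, 'oa, 'ob) two_party =
    Outputs "'a \<Rightarrow> 'oa" "'b \<Rightarrow> 'ob"
  | Alice_Sends "'a \<Rightarrow> bool" "('a, 'b, 'oa, 'ob) two_party" "('a, 'b, 'oa, 'ob) two_party"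
  | Bob_Sends "'b \<Rightarrow> bool" "('a, 'b, 'oa, 'ob) two_party" "('a, 'b, 'oa, 'ob) two_party"

primrec run :: "('a, 'b, 'oa, 'ob) two_party \<Rightarrow> 'a \<Rightarrow> 'b \<Rightarrow> 'oa \<times> 'ob" where
  "run (Outputs f g) a b = (f a, g b)"
| "run (Alice_Sends s p q) a b = (if s a then run q a b else run p a b)"
| "run (Bob_Sends s p q) a b = (if s b then run q a b else run p a b)"

primrec comm_complexity :: "('a, 'b, 'oa, 'ob) two_party \<Rightarrow> nat" where
  "comm_complexity (Outputs f g) = 0"
| "comm_complexity (Alice_Sends s p q) = Suc (max (comm_complexity p) (comm_complexity q))"
| "comm_complexity (Bob_Sends s p q) = Suc (max (comm_complexity p) (comm_complexity q))"

definition public_coins :: "(nat \<Rightarrow> bool) measure" where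
  "public_coins = (\<Pi>\<^sub>M i\<in>UNIV. fair_coin)"

definition L :: "nat \<Rightarrow> nat set" where
  "L \<eta> = {0..<\<eta>}"

definition R :: "nat \<Rightarrow> nat \<Rightarrow> nat set" where
  "R n \<eta> = {n - \<eta>..<n}"

type_synonym 'x party_view = "(nat \<Rightarrow> 'x) \<times> (nat \<Rightarrow> nat \<rightharpoonup> real)"

definition party_view :: "network \<Rightarrow> (nat \<Rightarrow> 'x) \<Rightarrow> nat set \<Rightarrow> 'x party_view" where
  "party_view G x S = (restrict x S, restrict (initial_state G) S)"

type_synonym ('x, 'y) public_coin_protocol =
  "(nat \<Rightarrow> bool) \<Rightarrow> ('x party_view, 'x party_view, nat \<Rightarrow> 'y, nat \<Rightarrow> 'y) two_party"

text \<open>For odd \<open>n\<close> the half \<open>n/2\<close> is rounded up: both parties output the value of the middle node and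
  have to agree on it, so that in all cases every node is covered. Of the outputs only the values
  of Alice on \<open>L\<close> and of Bob on \<open>R\<close> count.\<close>

definition eta_solves ::
  "nat \<Rightarrow> nat \<Rightarrow> ('x, 'y) public_coin_protocol \<Rightarrow> ('x, 'y) task \<Rightarrow> real \<Rightarrow> network \<Rightarrow> bool" where
  "eta_solves n \<eta> Q task \<epsilon> G \<longleftrightarrow>
     (\<forall>x \<in> verts G \<rightarrow>\<^sub>E UNIV.
        holds_with_prob public_coins
          (\<lambda>r. case run (Q r) (party_view G x (verts G - R n \<eta>)) (party_view G x (verts G - L \<eta>)) of
             (ya, yb) \<Rightarrow> \<exists>y \<in> verts G \<rightarrow>\<^sub>E UNIV. task G x y
                \<and> (\<forall>v \<in> L ((n + 1) div 2). y v = ya v)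
                \<and> (\<forall>v \<in> R n ((n + 1) div 2). y v = yb v))
          (1 - \<epsilon>))"

end

theory Submission
  imports Defs
begin

text \<open>Alice simulates after \<open>t\<close> rounds the nodes below \<open>n - \<eta> - t k\<close> and Bob those from
  \<open>\<eta> + t k\<close> on. To advance by one round, a party lacks only the messages that enter its next, \<open>k\<close>
  nodes smaller, zone from outside the present one. They cross a cut of weight at most \<open>c\<close>, so they
  have at most \<open>B c\<close> bits, and as long as \<open>2 t k \<le> n - 2 \<eta>\<close> the other party simulates their senders.
  Both parties know the edges at the cut and hence the format of the transmission. The
  functions that make up the two-party protocol are obtained by choice: it suffices that
  instances which look alike to a party lead to the same bits and outputs of that party.\<close>


section \<open>Protocol trees from indistinguishability\<close>

text \<open>\<open>bit j i\<close> is the \<open>j\<close>-th bit of the transcript on instance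
  \<open>i\<close>, sent by Alice iff \<open>alice j\<close>. A function of a party's knowledge and
  the transcript is expressed as equality on indistinguishable instances. The induction keeps
  \<open>X\<close> arbitrary, since each transmitted bit cuts \<open>X\<close> down to the instances
  that agree with it.\<close>

lemma bitwise_protocol:
  fixes a :: "'i \<Rightarrow> 'a" and b :: "'i \<Rightarrow> 'b" and oa :: "'i \<Rightarrow> 'oa" and ob :: "'i \<Rightarrow> 'ob"
    and bit :: "nat \<Rightarrow> 'i \<Rightarrow> bool" and alice :: "nat \<Rightarrow> bool"
  assumes "\<And>j i i'. \<lbrakk>j < N; alice j; i \<in> X; i' \<in> X; a i = a i'; \<forall>l<j. bit l i = bit l i'\<rbrakk>
             \<Longrightarrow> bit j i = bit j i'"
    and "\<And>j i i'. \<lbrakk>j < N; \<not> alice j; i \<in> X; i' \<in> X; b i = b i'; \<forall>l<j. bit l i = bit l i'\<rbrakk>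
             \<Longrightarrow> bit j i = bit j i'"
    and "\<And>i i'. \<lbrakk>i \<in> X; i' \<in> X; a i = a i'; \<forall>l<N. bit l i = bit l i'\<rbrakk> \<Longrightarrow> oa i = oa i'"
    and "\<And>i i'. \<lbrakk>i \<in> X; i' \<in> X; b i = b i'; \<forall>l<N. bit l i = bit l i'\<rbrakk> \<Longrightarrow> ob i = ob i'"
  shows "\<exists>p. comm_complexity p = N \<and> (\<forall>i\<in>X. run p (a i) (b i) = (oa i, ob i))"
  using assms
proof (induction N arbitrary: X bit alice)
  case 0
  \<comment> \<open>With no bits to exchange, all instances in \<open>X\<close> that share Alice's
    knowledge share her output, so any of them may serve as representative; \<open>g\<close> does
    the same for Bob.\<close>
  define f where "f z = oa (SOME i. i \<in> X \<and> a i = z)" for z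
  define g where "g z = ob (SOME i. i \<in> X \<and> b i = z)" for z
  have "f (a i) = oa i" if "i \<in> X" for i
    unfolding f_def using someI[of "\<lambda>j. j \<in> X \<and> a j = a i" i] that by (intro 0(3)) auto
  moreover have "g (b i) = ob i" if "i \<in> X" for i
    unfolding g_def using someI[of "\<lambda>j. j \<in> X \<and> b j = b i" i] that by (intro 0(4)) auto
  ultimately show ?case
    by (intro exI[of _ "Outputs f g"]) auto
next
  case (Suc N)
  \<comment> \<open>Below the first bit \<open>c\<close> only instances with that bit remain.
    Agreement on bit 0 is then automatic and the other bits move down by one index.\<close>
  have "\<exists>p. comm_complexity p = N \<and> (\<forall>i\<in>{i \<in> X. bit 0 i = c}. run p (a i) (b i) = (oa i, ob i))"
    for c
  proof (rule Suc.IH[where bit = "\<lambda>j. bit (Suc j)" and alice = "\<lambda>j. alice (Suc j)"])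
    fix j i i'
    assume "j < N" "alice (Suc j)" "i \<in> {i \<in> X. bit 0 i = c}" "i' \<in> {i \<in> X. bit 0 i = c}"
      "a i = a i'" "\<forall>l<j. bit (Suc l) i = bit (Suc l) i'"
    then show "bit (Suc j) i = bit (Suc j) i'"
      by (intro Suc.prems(1)) (auto simp: All_less_Suc2)
  next
    fix j i i'
    assume "j < N" "\<not> alice (Suc j)" "i \<in> {i \<in> X. bit 0 i = c}" "i' \<in> {i \<in> X. bit 0 i = c}"
      "b i = b i'" "\<forall>l<j. bit (Suc l) i = bit (Suc l) i'"
    then show "bit (Suc j) i = bit (Suc j) i'"
      by (intro Suc.prems(2)) (auto simp: All_less_Suc2)
  next
    fix i i'
    assume "i \<in> {i \<in> X. bit 0 i = c}" "i' \<in> {i \<in> X. bit 0 i = c}"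
      "a i = a i'" "\<forall>l<N. bit (Suc l) i = bit (Suc l) i'"
    then show "oa i = oa i'"
      by (intro Suc.prems(3)) (auto simp: All_less_Suc2)
  next
    fix i i'
    assume "i \<in> {i \<in> X. bit 0 i = c}" "i' \<in> {i \<in> X. bit 0 i = c}"
      "b i = b i'" "\<forall>l<N. bit (Suc l) i = bit (Suc l) i'"
    then show "ob i = ob i'"
      by (intro Suc.prems(4)) (auto simp: All_less_Suc2)
  qed
  then obtain p where p: "comm_complexity (p c) = N"
    "\<And>i. i \<in> X \<Longrightarrow> bit 0 i = c \<Longrightarrow> run (p c) (a i) (b i) = (oa i, ob i)" for c
    by simp metis
  show ?case
  proof (cases "alice 0")
    case True
    \<comment> \<open>No bit precedes bit 0, so all instances that Alice cannot tell apart have the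
      same one, and asking for the existence of one with a true bit computes it.\<close>
    have "(\<exists>j\<in>X. a j = a i \<and> bit 0 j) = bit 0 i" if "i \<in> X" for i
      using Suc.prems(1)[OF _ True] that by (metis not_less0 zero_less_Suc)
    then show ?thesis
      using p by (intro exI[of _ "Alice_Sends (\<lambda>z. \<exists>j\<in>X. a j = z \<and> bit 0 j) (p False) (p True)"]) auto
  next
    case False
    have "(\<exists>j\<in>X. b j = b i \<and> bit 0 j) = bit 0 i" if "i \<in> X" for i
      using Suc.prems(2)[OF _ False] that by (metis not_less0 zero_less_Suc)
    then show ?thesis
      using p by (intro exI[of _ "Bob_Sends (\<lambda>z. \<exists>j\<in>X. b j = z \<and> bit 0 j) (p False) (p True)"]) auto
  qed
qed

text \<open>The transcript is laid out as one block of \<open>2 * m\<close> bits per round, Alice's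
  half first. As all halves have length \<open>m\<close>, a bit position alone determines the round
  and the sender.\<close>

lemma blockwise_protocol:
  fixes a :: "'i \<Rightarrow> 'a" and b :: "'i \<Rightarrow> 'b" and oa :: "'i \<Rightarrow> 'oa" and ob :: "'i \<Rightarrow> 'ob"
    and \<alpha> \<beta> :: "nat \<Rightarrow> 'i \<Rightarrow> bool list"
  assumes len: "\<And>t i. t < T \<Longrightarrow> i \<in> X \<Longrightarrow> length (\<alpha> t i) = m"
      "\<And>t i. t < T \<Longrightarrow> i \<in> X \<Longrightarrow> length (\<beta> t i) = m"
    and alice: "\<And>t i i'. \<lbrakk>t < T; i \<in> X; i' \<in> X; a i = a i'; \<forall>s<t. \<beta> s i = \<beta> s i'\<rbrakk>
      \<Longrightarrow> \<alpha> t i = \<alpha> t i'"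
    and bob: "\<And>t i i'. \<lbrakk>t < T; i \<in> X; i' \<in> X; b i = b i'; \<forall>s<t. \<alpha> s i = \<alpha> s i'\<rbrakk>
      \<Longrightarrow> \<beta> t i = \<beta> t i'"
    and oa: "\<And>i i'. \<lbrakk>i \<in> X; i' \<in> X; a i = a i'; \<forall>s<T. \<beta> s i = \<beta> s i'\<rbrakk> \<Longrightarrow> oa i = oa i'"
    and ob: "\<And>i i'. \<lbrakk>i \<in> X; i' \<in> X; b i = b i'; \<forall>s<T. \<alpha> s i = \<alpha> s i'\<rbrakk> \<Longrightarrow> ob i = ob i'"
  shows "\<exists>p. comm_complexity p = T * (2 * m) \<and> (\<forall>i\<in>X. run p (a i) (b i) = (oa i, ob i))"
proof -
  define w where "w = 2 * m"
  define bit where "bit j i = (\<alpha> (j div w) i @ \<beta> (j div w) i) ! (j mod w)" for j i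
  \<comment> \<open>Agreement on all bits before position \<open>j\<close> gives agreement on every
    block completed by then; the bits of an unfinished block are ignored.\<close>
  have same: "\<forall>s<t. \<alpha> s i = \<alpha> s i' \<and> \<beta> s i = \<beta> s i'"
    if "t \<le> T" "i \<in> X" "i' \<in> X" and eq: "\<forall>l<j. bit l i = bit l i'" and j: "t * w \<le> j" for t j i i'
  proof (intro allI impI)
    fix s assume s: "s < t"
    have "\<alpha> s i @ \<beta> s i = \<alpha> s i' @ \<beta> s i'"
    proof (rule nth_equalityI)
      show "length (\<alpha> s i @ \<beta> s i) = length (\<alpha> s i' @ \<beta> s i')"
        using that s len by simp
      fix q assume "q < length (\<alpha> s i @ \<beta> s i)"
      then have q: "q < w" using that s len by (simp add: w_def)
      have "s * w + q < Suc s * w" using q by simp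
      also have "\<dots> \<le> t * w" using s by (intro mult_right_mono) auto
      finally have "bit (s * w + q) i = bit (s * w + q) i'" using eq j by auto
      then show "(\<alpha> s i @ \<beta> s i) ! q = (\<alpha> s i' @ \<beta> s i') ! q"
        using q by (simp add: bit_def)
    qed
    then show "\<alpha> s i = \<alpha> s i' \<and> \<beta> s i = \<beta> s i'"
      using that s len by simp
  qed
  have div: "j div w < T" if "j < T * w" for j
    using that by (simp add: less_mult_imp_div_less)
  have mod: "j mod w < w" if "j < T * w" for j
    using that by (cases "w = 0") auto
  show ?thesis
    unfolding w_def[symmetric]
  proof (rule bitwise_protocol[where bit = bit and alice = "\<lambda>j. j mod w < m"])
    fix j i i'
    assume *: "j < T * w" "j mod w < m" "i \<in> X" "i' \<in> X" "a i = a i'" "\<forall>l<j. bit l i = bit l i'"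
    have "\<alpha> (j div w) i = \<alpha> (j div w) i'"
      using * div[of j] same[of "j div w" i i' j] by (intro alice) auto
    then show "bit j i = bit j i'"
      using * div[of j] len by (simp add: bit_def nth_append)
  next
    fix j i i'
    assume *: "j < T * w" "\<not> j mod w < m" "i \<in> X" "i' \<in> X" "b i = b i'" "\<forall>l<j. bit l i = bit l i'"
    have "\<beta> (j div w) i = \<beta> (j div w) i'"
      using * div[of j] same[of "j div w" i i' j] by (intro bob) auto
    then show "bit j i = bit j i'"
      using * div[of j] len by (simp add: bit_def nth_append)
  next
    fix i i'
    assume "i \<in> X" "i' \<in> X" "a i = a i'" "\<forall>l<T * w. bit l i = bit l i'"
    then show "oa i = oa i'"
      using same[of T i i' "T * w"] by (intro oa) auto
  next
    fix i i'
    assume "i \<in> X" "i' \<in> X" "b i = b i'" "\<forall>l<T * w. bit l i = bit l i'"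
    then show "ob i = ob i'"
      using same[of T i i' "T * w"] by (intro ob) auto
  qed
qed


section \<open>Messages across a cut\<close>

lemma length_pad: "length (pad b m) = max b (length m)"
  by (simp add: pad_def)

text \<open>Padding blurs where a list ends, so the length must be known from elsewhere; later it
  comes from the capacities of the edges at the receivers.\<close>

lemma pad_inject: "pad b m = pad b m' \<Longrightarrow> length m = length m' \<Longrightarrow> m = m'"
  by (simp add: pad_def)

lemma edges_eq_if_initial_state_eq:
  assumes "initial_state G v = initial_state G' v"
  shows "{u, v} \<in> edges G \<longleftrightarrow> {u, v} \<in> edges G'"
    and "{u, v} \<in> edges G \<Longrightarrow> weight G {u, v} = weight G' {u, v}"
  using fun_cong[OF assms, of u] by (auto simp: initial_state_def split: if_splits)

context
  fixes B :: real and P :: "('x, 'y) dist_protocol" and \<omega> :: "nat \<times> nat \<Rightarrow> bool"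
begin

definition message :: "network \<Rightarrow> (nat \<Rightarrow> 'x) \<Rightarrow> nat \<Rightarrow> nat \<Rightarrow> nat \<Rightarrow> bool list" where
  "message G x t u v = (if {u, v} \<in> edges G
     then pad (nat \<lfloor>B * weight G {u, v}\<rfloor>) (send_to P (view_after B P G x \<omega> t u) v) else [])"

text \<open>Running over all pairs in a fixed order, with empty lists for non-edges, makes the
  arrangement independent of the network, so that two networks can be compared pair by pair.\<close>

definition messages_across :: "network \<Rightarrow> (nat \<Rightarrow> 'x) \<Rightarrow> nat \<Rightarrow> nat set \<Rightarrow> nat set \<Rightarrow> bool list" where
  "messages_across G x t X Y = concat (map (\<lambda>(u, v). message G x t u v)
     (List.product (sorted_list_of_set X) (sorted_list_of_set Y)))"

lemma received_Suc:
  "received B P G x \<omega> (Suc t) v = received B P G x \<omega> t v @ [\<lambda>u. message G x t u v]"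
  unfolding message_def view_after_def by simp

declare received.simps(2) [simp del]

text \<open>The sender's view contains its initial state, which settles whether there is an edge to
  \<open>v\<close> and how far the message is padded.\<close>

lemma message_eq_if_view_eq:
  assumes "view_after B P G x \<omega> t u = view_after B P G' x' \<omega> t u"
  shows "message G x t u v = message G' x' t u v"
proof -
  have "initial_state G u = initial_state G' u"
    using assms by (simp add: view_after_def)
  from edges_eq_if_initial_state_eq[OF this, of v] show ?thesis
    by (simp add: message_def insert_commute assms)
qed

lemma messages_across_eq_if_view_eq:
  assumes "finite X" "finite Y"
    and "\<And>u. u \<in> X \<Longrightarrow> view_after B P G x \<omega> t u = view_after B P G' x' \<omega> t u"
  shows "messages_across G x t X Y = messages_across G' x' t X Y"
  unfolding messages_across_def
  using assms(1,2)
  by (intro arg_cong[of _ _ concat] map_cong) (auto intro: message_eq_if_view_eq assms(3))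

text \<open>A message within the bandwidth has at most the rounded-down capacity as length, and
  padding fills it up exactly: the length depends on the edge but not on the content.\<close>

lemma length_message:
  assumes "respects_bandwidth B P T G" "x \<in> verts G \<rightarrow>\<^sub>E UNIV" "\<omega> \<in> space (node_coins G)" "t < T"
  shows "length (message G x t u v) = (if {u, v} \<in> edges G then nat \<lfloor>B * weight G {u, v}\<rfloor> else 0)"
proof (cases "{u, v} \<in> edges G")
  case True
  then have "real (length (send_to P (view_after B P G x \<omega> t u) v)) \<le> B * weight G {u, v}"
    using assms by (auto simp: respects_bandwidth_def)
  then show ?thesis
    using True by (simp add: message_def length_pad le_nat_floor)
qed (simp add: message_def)

text \<open>A concatenation splits uniquely into its pieces once their lengths are known to
  agree.\<close>

lemma message_eq_if_messages_across_eq: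
  assumes "messages_across G x t X Y = messages_across G' x' t X Y" "finite X" "finite Y"
    and "\<And>u v. u \<in> X \<Longrightarrow> v \<in> Y \<Longrightarrow> length (message G x t u v) = length (message G' x' t u v)"
    and "u \<in> X" "v \<in> Y"
  shows "message G x t u v = message G' x' t u v"
proof -
  let ?ps = "List.product (sorted_list_of_set X) (sorted_list_of_set Y)"
  have "map (\<lambda>(u, v). message G x t u v) ?ps = map (\<lambda>(u, v). message G' x' t u v) ?ps"
    using assms by (intro concat_injective) (auto simp: messages_across_def zip_map_map zip_same_conv_map)
  then show ?thesis
    using assms by auto
qed

text \<open>Rounding down edge by edge keeps the total below \<open>B\<close> times the weight of
  the cut. Since \<open>X\<close> and \<open>Y\<close> are disjoint, each edge between them has only
  one orientation from \<open>X\<close> to \<open>Y\<close> and is counted once.\<close>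

lemma length_messages_across:
  assumes bw: "respects_bandwidth B P T G" "x \<in> verts G \<rightarrow>\<^sub>E UNIV" "\<omega> \<in> space (node_coins G)" "t < T"
    and fin: "finite X" "finite Y" and "X \<inter> Y = {}" and "B \<ge> 0"
    and c: "weight_between G X Y \<le> c" and w: "\<And>e. e \<in> edges G \<Longrightarrow> weight G e \<ge> 0"
  shows "length (messages_across G x t X Y) \<le> nat \<lfloor>B * c\<rfloor>"
proof -
  let ?E = "{(u, v). u \<in> X \<and> v \<in> Y \<and> {u, v} \<in> edges G}"
  have inj: "inj_on (\<lambda>(u, v). {u, v}) ?E"
    using \<open>X \<inter> Y = {}\<close> by (auto simp: inj_on_def doubleton_eq_iff)
  have "length (messages_across G x t X Y) = (\<Sum>(u, v)\<in>X \<times> Y. length (message G x t u v))"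
    using fin
    by (simp add: messages_across_def length_concat comp_def case_prod_unfold
        sum_list_distinct_conv_sum_set distinct_product)
  also have "\<dots> = (\<Sum>(u, v)\<in>?E. nat \<lfloor>B * weight G {u, v}\<rfloor>)"
    using fin by (intro sum.mono_neutral_cong_right) (auto simp: length_message[OF bw] split: if_splits)
  finally have "real (length (messages_across G x t X Y))
      = (\<Sum>(u, v)\<in>?E. real (nat \<lfloor>B * weight G {u, v}\<rfloor>))"
    by (simp add: case_prod_unfold)
  also have "\<dots> \<le> (\<Sum>(u, v)\<in>?E. B * weight G {u, v})"
    using w \<open>B \<ge> 0\<close> by (intro sum_mono) auto
  also have "\<dots> = B * (\<Sum>e\<in>(\<lambda>(u, v). {u, v}) ` ?E. weight G e)"
    by (subst sum.reindex[OF inj]) (simp add: sum_distrib_left comp_def case_prod_unfold)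
  also have "(\<lambda>(u, v). {u, v}) ` ?E = {e \<in> edges G. \<exists>u\<in>X. \<exists>v\<in>Y. e = {u, v}}"
    by auto
  finally have "real (length (messages_across G x t X Y)) \<le> B * weight_between G X Y"
    by (simp add: weight_between_def)
  also have "\<dots> \<le> B * c"
    using c \<open>B \<ge> 0\<close> by (rule mult_left_mono)
  finally show ?thesis
    by (simp add: le_nat_floor)
qed

text \<open>A party that initially knows the nodes of \<open>K 0\<close> and is told the messages from outside \<open>K s\<close> to
  \<open>K (Suc s)\<close> can keep track of \<open>K t\<close>.\<close>

lemma view_eq_if_crossing_eq:
  fixes K :: "nat \<Rightarrow> nat set"
  assumes G: "wf_network G" "verts G = V" "respects_bandwidth B P T G" "x \<in> V \<rightarrow>\<^sub>E UNIV"
    and G': "wf_network G'" "verts G' = V" "respects_bandwidth B P T G'" "x' \<in> V \<rightarrow>\<^sub>E UNIV"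
    and \<omega>: "\<omega> \<in> space (node_coins G)"
    and K: "\<And>t. K t \<subseteq> V" "antimono K"
    and known: "party_view G x (K 0) = party_view G' x' (K 0)"
    and crossing: "\<forall>s<t. pad b (messages_across G x s (V - K s) (K (Suc s)))
        = pad b (messages_across G' x' s (V - K s) (K (Suc s)))"
    and "t \<le> T" "v \<in> K t"
  shows "view_after B P G x \<omega> t v = view_after B P G' x' \<omega> t v"
proof -
  have \<omega>': "\<omega> \<in> space (node_coins G')"
    using \<omega> G G' by (simp add: node_coins_def)
  have init: "x u = x' u \<and> initial_state G u = initial_state G' u" if "u \<in> K s" for u s
  proof -
    have "u \<in> K 0" using that antimonoD[OF K(2), of 0 s] by auto
    then show ?thesis
      using known by (auto simp: party_view_def dest: fun_cong[of _ _ u])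
  qed
  have "finite V" using G by (auto simp: wf_network_def)
  then have finK: "finite (K s)" for s using K finite_subset by blast
  from crossing \<open>t \<le> T\<close> \<open>v \<in> K t\<close> show ?thesis
  proof (induction t arbitrary: v)
    case 0
    then show ?case using init by (simp add: view_after_def)
  next
    case (Suc t)
    have IH: "view_after B P G x \<omega> t u = view_after B P G' x' \<omega> t u" if "u \<in> K t" for u
      using Suc that by simp
    have bw: "respects_bandwidth B P T G" "x \<in> verts G \<rightarrow>\<^sub>E UNIV" "\<omega> \<in> space (node_coins G)" "t < T"
      and bw': "respects_bandwidth B P T G'" "x' \<in> verts G' \<rightarrow>\<^sub>E UNIV" "\<omega> \<in> space (node_coins G')" "t < T"
      using G G' \<omega> \<omega>' Suc.prems by auto
    \<comment> \<open>The receiver lies in \<open>K 0\<close>, where the initial states agree, so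
      its edges have the same capacities in both networks. This fixes the format of the transmission
      before it is read.\<close>
    have len: "length (message G x t u v) = length (message G' x' t u v)" if "v \<in> K (Suc t)" for u v
      using init[OF that] edges_eq_if_initial_state_eq[of G v G' u]
      by (simp add: length_message[OF bw] length_message[OF bw'])
    have "v \<in> K t" using Suc.prems antimonoD[OF K(2), of t "Suc t"] by auto
    have "messages_across G x t (V - K t) (K (Suc t)) = messages_across G' x' t (V - K t) (K (Suc t))"
    proof (rule pad_inject)
      show "pad b (messages_across G x t (V - K t) (K (Suc t)))
        = pad b (messages_across G' x' t (V - K t) (K (Suc t)))"
        using Suc.prems by simp
      show "length (messages_across G x t (V - K t) (K (Suc t)))
        = length (messages_across G' x' t (V - K t) (K (Suc t)))"
        unfolding messages_across_def length_concat map_map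
        using len finK by (intro arg_cong[of _ _ sum_list] map_cong) auto
    qed
    note across = message_eq_if_messages_across_eq[OF this]
    have "message G x t u v = message G' x' t u v" for u
    proof -
      \<comment> \<open>A sender in the zone has the same view in both runs by induction, the
        message of one outside it is part of the transmission, and a non-node has no edges.\<close>
      consider "u \<in> K t" | "u \<in> V - K t" | "u \<notin> V" by blast
      then show ?thesis
      proof cases
        case 1
        then show ?thesis by (intro message_eq_if_view_eq IH)
      next
        case 2
        then show ?thesis using across[of u v] \<open>finite V\<close> finK len Suc.prems by auto
      next
        case 3
        then have "{u, v} \<notin> edges G" "{u, v} \<notin> edges G'"
          using G G' by (auto simp: wf_network_def)
        then show ?thesis by (simp add: message_def)
      qed
    qed
    then show ?case
      using IH[OF \<open>v \<in> K t\<close>] by (simp add: view_after_def received_Suc)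
  qed
qed

end


section \<open>The simulation\<close>

lemma weight_between_commute: "weight_between G X Y = weight_between G Y X"
  unfolding weight_between_def by (rule arg_cong[of _ _ "sum _"], rule Collect_cong) (metis insert_commute)

text \<open>One tree must serve all networks and inputs, so the instances are the pairs
  \<open>(G, x)\<close>. The coins \<open>\<omega>\<close> are fixed and shared, hence a party also
  knows the coins of nodes that enter its simulation.\<close>

lemma deterministic_simulation:
  fixes P :: "('x, 'y) dist_protocol"
  assumes "\<eta> > 0" "B \<ge> 0" and fam: "\<G> \<subseteq> graph_family n k c"
    and T: "2 * (T * k) + 2 * \<eta> \<le> n"
    and bw: "\<And>G. G \<in> \<G> \<Longrightarrow> respects_bandwidth B P T G"
    and \<omega>: "\<omega> \<in> {0..<n} \<times> UNIV \<rightarrow>\<^sub>E UNIV"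
  shows "\<exists>p. comm_complexity p = T * (2 * nat \<lfloor>B * c\<rfloor>) \<and>
    (\<forall>G\<in>\<G>. \<forall>x\<in>{0..<n} \<rightarrow>\<^sub>E UNIV.
      run p (party_view G x (verts G - R n \<eta>)) (party_view G x (verts G - L \<eta>))
       = (restrict (dist_outputs B P G x \<omega> T) (L ((n + 1) div 2)),
          restrict (dist_outputs B P G x \<omega> T) (R n ((n + 1) div 2))))"
proof -
  define m where "m = nat \<lfloor>B * c\<rfloor>"
  define V where "V = {0..<n}"
  define d where "d t = t * k" for t
  define KA where "KA t = {0..<n - \<eta> - d t}" for t
  define KB where "KB t = {\<eta> + d t..<n}" for t
  \<comment> \<open>\<open>cross K t\<close> is what the party tracking \<open>K\<close> has to be
    told in round \<open>t\<close>. The number of bits crossing the cut varies with the network;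
    padding to \<open>m\<close> makes the block length uniform.\<close>
  define cross where
    "cross K t = (\<lambda>(G, x). pad m (messages_across B P \<omega> G x t (V - K t) (K (Suc t))))" for K t
  have d_mono: "d s \<le> d t" if "s \<le> t" for s t
    using that by (simp add: d_def)
  have d_0: "d 0 = 0" and d_Suc: "d (Suc t) = d t + k" for t
    by (simp_all add: d_def)
  have d_T: "2 * d T + 2 * \<eta> \<le> n"
    using T by (simp add: d_def)
  have G: "wf_network G" "verts G = V" "\<And>e. e \<in> edges G \<Longrightarrow> weight G e \<ge> 0"
      "\<And>h. h < n \<Longrightarrow> weight_between G {0..h} {h + k + 1..<n} \<le> c"
    if "G \<in> \<G>" for G
  proof -
    have *: "G \<in> graph_family n k c" using that fam by auto
    then show "wf_network G" "verts G = V"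
      by (auto simp: graph_family_def V_def)
    show "weight G e \<ge> 0" if "e \<in> edges G" for e
      using * that by (force simp: graph_family_def wf_network_def)
    show "weight_between G {0..h} {h + k + 1..<n} \<le> c" if "h < n" for h
      using * that by (simp add: graph_family_def)
  qed
  have coins: "\<omega> \<in> space (node_coins G)" if "G \<in> \<G>" for G
    using \<omega> G(2)[OF that] by (simp add: node_coins_def space_PiM V_def)
  have "KA t \<subseteq> KA s \<and> KB t \<subseteq> KB s" if "s \<le> t" for s t
    using d_mono[OF that] by (auto simp: KA_def KB_def)
  then have "antimono KA" "antimono KB"
    by (auto intro!: antimonoI)
  moreover have "KA t \<subseteq> V" "KB t \<subseteq> V" for t
    by (auto simp: KA_def KB_def V_def)
  ultimately have KA: "KA t \<subseteq> V" "antimono KA" and KB: "KB t \<subseteq> V" "antimono KB" for t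
    by simp_all
  have fin: "finite V" "finite (KA t)" "finite (KB t)" for t
    by (auto simp: KA_def KB_def V_def)
  \<comment> \<open>The bound on \<open>T\<close> yields
    \<open>\<eta> + d t \<le> n - \<eta> - d t\<close>, so the zones together still cover all nodes
    and whatever lies outside one is tracked by the other party.\<close>
  have cover: "V - KA t \<subseteq> KB t" "V - KB t \<subseteq> KA t" if "t \<le> T" for t
    using d_mono[OF that] d_T by (auto simp: KA_def KB_def V_def)

  have length_cross: "length (cross K t (G, x)) = m"
    if "G \<in> \<G>" "x \<in> V \<rightarrow>\<^sub>E UNIV" "t < T" "\<And>t. finite (K t)" "antimono K"
      "weight_between G (V - K t) (K (Suc t)) \<le> c" for G x K t
  proof -
    have "K (Suc t) \<subseteq> K t" using that(5) by (simp add: antimonoD)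
    then have "length (messages_across B P \<omega> G x t (V - K t) (K (Suc t))) \<le> m"
      unfolding m_def using that G[OF that(1)] bw coins fin \<open>B \<ge> 0\<close>
      by (intro length_messages_across) auto
    then show ?thesis by (simp add: cross_def length_pad)
  qed
  have wA: "weight_between G (V - KA t) (KA (Suc t)) \<le> c" if "G \<in> \<G>" "t < T" for G t
  proof -
    \<comment> \<open>\<open>h\<close> is the last node of \<open>KA (Suc t)\<close>, which is
      nonempty by the bound on \<open>T\<close> and \<open>\<eta> > 0\<close>; then
      \<open>h + k + 1\<close> is the first node outside \<open>KA t\<close>.\<close>
    define h where "h = n - \<eta> - d (Suc t) - 1"
    have "d (Suc t) \<le> d T" using that by (simp add: d_mono)
    then have "V - KA t = {h + k + 1..<n}" "KA (Suc t) = {0..h}" "h < n"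
      using d_T \<open>\<eta> > 0\<close> by (auto simp: KA_def V_def h_def d_Suc)
    then show ?thesis using G(4)[OF that(1)] by (simp add: weight_between_commute)
  qed
  have wB: "weight_between G (V - KB t) (KB (Suc t)) \<le> c" if "G \<in> \<G>" "t < T" for G t
  proof -
    \<comment> \<open>On Bob's side \<open>h\<close> is the last node outside \<open>KB t\<close>.
      It exists because \<open>\<eta> > 0\<close>, so the subtraction is not truncated.\<close>
    define h where "h = \<eta> + d t - 1"
    have "d (Suc t) \<le> d T" using that by (simp add: d_mono)
    then have "V - KB t = {0..h}" "KB (Suc t) = {h + k + 1..<n}" "h < n"
      using d_T \<open>\<eta> > 0\<close> by (auto simp: KB_def V_def h_def d_Suc)
    then show ?thesis using G(4)[OF that(1)] by simp
  qed

  have view_eq: "view_after B P G x \<omega> t v = view_after B P G' x' \<omega> t v"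
    if "G \<in> \<G>" "x \<in> V \<rightarrow>\<^sub>E UNIV" "G' \<in> \<G>" "x' \<in> V \<rightarrow>\<^sub>E UNIV"
      "\<And>t. K t \<subseteq> V" "antimono K" "party_view G x (K 0) = party_view G' x' (K 0)"
      "\<forall>s<t. cross K s (G, x) = cross K s (G', x')" "t \<le> T" "v \<in> K t" for G x G' x' K t v
    by (rule view_eq_if_crossing_eq[where K = K and V = V and b = m and T = T])
      (use that G bw coins in \<open>auto simp: cross_def\<close>)
  \<comment> \<open>\<open>K\<close> is the zone of the party that sends and \<open>K'\<close> that
    of the party that receives. All origins of the transmitted messages lie in \<open>K t\<close>,
    so the sender's knowledge and the earlier blocks determine the block.\<close>
  have cross_eq: "cross K' t (G, x) = cross K' t (G', x')"
    if "G \<in> \<G>" "x \<in> V \<rightarrow>\<^sub>E UNIV" "G' \<in> \<G>" "x' \<in> V \<rightarrow>\<^sub>E UNIV"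
      "\<And>t. K t \<subseteq> V" "antimono K" "party_view G x (K 0) = party_view G' x' (K 0)"
      "\<forall>s<t. cross K s (G, x) = cross K s (G', x')" "t \<le> T"
      "V - K' t \<subseteq> K t" "finite (K' (Suc t))" for G x G' x' K K' t
    unfolding cross_def prod.case
    by (intro arg_cong[of _ _ "pad m"] messages_across_eq_if_view_eq view_eq[where K = K])
      (use that fin in auto)
  have out_eq: "restrict (dist_outputs B P G x \<omega> T) S = restrict (dist_outputs B P G' x' \<omega> T) S"
    if "G \<in> \<G>" "x \<in> V \<rightarrow>\<^sub>E UNIV" "G' \<in> \<G>" "x' \<in> V \<rightarrow>\<^sub>E UNIV"
      "\<And>t. K t \<subseteq> V" "antimono K" "party_view G x (K 0) = party_view G' x' (K 0)"
      "\<forall>s<T. cross K s (G, x) = cross K s (G', x')" "S \<subseteq> K T" for G x G' x' K S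
    using view_eq[OF that(1-8) order_refl] that(9) G(2) that(1,3)
    by (intro restrict_ext) (auto simp: dist_outputs_def)

  let ?X = "\<G> \<times> (V \<rightarrow>\<^sub>E UNIV)"
  \<comment> \<open>By \<open>2 * d T + 2 * \<eta> \<le> n\<close> each final zone has at least half
    of the nodes, hence at least \<open>(n + 1) div 2\<close> by integrality.\<close>
  have LA: "L ((n + 1) div 2) \<subseteq> KA T" and RB: "R n ((n + 1) div 2) \<subseteq> KB T"
    using d_T by (auto simp: L_def R_def KA_def KB_def)
  have "\<exists>p. comm_complexity p = T * (2 * m) \<and>
    (\<forall>i\<in>?X. run p ((\<lambda>(G, x). party_view G x (KA 0)) i) ((\<lambda>(G, x). party_view G x (KB 0)) i)
       = ((\<lambda>(G, x). restrict (dist_outputs B P G x \<omega> T) (L ((n + 1) div 2))) i,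
          (\<lambda>(G, x). restrict (dist_outputs B P G x \<omega> T) (R n ((n + 1) div 2))) i))"
  \<comment> \<open>Each party sends what enters the zone of the other: Alice the blocks for
    \<open>KB\<close>, Bob those for \<open>KA\<close>.\<close>
  proof (rule blockwise_protocol[where \<alpha> = "cross KB" and \<beta> = "cross KA"], goal_cases)
    case (1 t i)
    then show ?case using length_cross[of _ _ t KB] fin KB wB by auto
  next
    case (2 t i)
    then show ?case using length_cross[of _ _ t KA] fin KA wA by auto
  next
    case (3 t i i')
    obtain G x G' x' where i: "i = (G, x)" "i' = (G', x')" by (cases i, cases i')
    show ?case
      unfolding i prod.case by (rule cross_eq[where K = KA]) (use 3 i fin KA cover in simp_all)
  next
    case (4 t i i')
    obtain G x G' x' where i: "i = (G, x)" "i' = (G', x')" by (cases i, cases i')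
    show ?case
      unfolding i prod.case by (rule cross_eq[where K = KB]) (use 4 i fin KB cover in simp_all)
  next
    case (5 i i')
    obtain G x G' x' where i: "i = (G, x)" "i' = (G', x')" by (cases i, cases i')
    show ?case
      unfolding i prod.case by (rule out_eq[where K = KA]) (use 5 i KA LA in simp_all)
  next
    case (6 i i')
    obtain G x G' x' where i: "i = (G, x)" "i' = (G', x')" by (cases i, cases i')
    show ?case
      unfolding i prod.case by (rule out_eq[where K = KB]) (use 6 i KB RB in simp_all)
  qed
  then obtain p where "comm_complexity p = T * (2 * m)" and
    "\<And>G x. G \<in> \<G> \<Longrightarrow> x \<in> V \<rightarrow>\<^sub>E UNIV \<Longrightarrow> run p (party_view G x (KA 0)) (party_view G x (KB 0))
       = (restrict (dist_outputs B P G x \<omega> T) (L ((n + 1) div 2)),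
          restrict (dist_outputs B P G x \<omega> T) (R n ((n + 1) div 2)))"
    by fastforce
  moreover have "verts G - R n \<eta> = KA 0" "verts G - L \<eta> = KB 0" if "G \<in> \<G>" for G
    unfolding G(2)[OF that] V_def R_def L_def KA_def KB_def d_0 using d_T by auto
  ultimately show ?thesis
    unfolding m_def V_def by (intro exI[of _ p]) simp
qed

section \<open>Private coins from the public random string\<close>

definition coins_of :: "nat \<Rightarrow> (nat \<Rightarrow> bool) \<Rightarrow> nat \<times> nat \<Rightarrow> bool" where
  "coins_of n r = (\<lambda>p\<in>{0..<n} \<times> UNIV. r (prod_encode p))"

text \<open>The pairing function assigns distinct public tosses to distinct pairs of node and index.
  Selecting coordinates of a product of identical factors along an injection again gives the
  product.\<close>

lemma distr_coins_of:
  assumes "verts G = {0..<n}"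
  shows "distr public_coins (node_coins G) (coins_of n) = node_coins G"
  unfolding public_coins_def node_coins_def coins_of_def assms
  by (rule distr_PiM_reindex) (simp_all add: inj_prod_encode prob_space_measure_pmf)

lemma measurable_coins_of:
  assumes "verts G = {0..<n}"
  shows "coins_of n \<in> measurable public_coins (node_coins G)"
  unfolding public_coins_def node_coins_def coins_of_def assms
  by (rule measurable_restrict) (rule measurable_component_singleton, simp)

text \<open>Each public string \<open>r\<close> selects the tree that simulates the run with coins
  \<open>coins_of n r\<close>. Success of the two parties is then the preimage of success of the
  distributed run, so the probabilities coincide.\<close>

theorem theorem6p1:
  fixes n k \<eta> T :: nat and B c \<epsilon> :: real
    and \<G> :: "network set" and task :: "('x, 'y) task"
  assumes "n > 0" and "k > 0" and "\<eta> > 0" and "c \<ge> 1" and "B \<ge> 0"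
    and "\<G> \<subseteq> graph_family n k c"
    and "real T \<le> (real n - 2 * real \<eta>) / (2 * real k)"
    and "\<exists>P :: ('x, 'y) dist_protocol. \<forall>G\<in>\<G>. dist_solves B P T task \<epsilon> G"
  shows "\<exists>Q :: ('x, 'y) public_coin_protocol.
           (\<forall>G\<in>\<G>. eta_solves n \<eta> Q task \<epsilon> G)
         \<and> (\<forall>r. real (comm_complexity (Q r)) \<le> 2 * B * c * real T)"
proof -
  obtain P :: "('x, 'y) dist_protocol" where P: "\<And>G. G \<in> \<G> \<Longrightarrow> dist_solves B P T task \<epsilon> G"
    using assms(8) by blast
  have "real (2 * (T * k) + 2 * \<eta>) \<le> real n"
    using assms(2,7) by (simp add: field_simps)
  then have T: "2 * (T * k) + 2 * \<eta> \<le> n"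
    by linarith
  have V: "verts G = {0..<n}" if "G \<in> \<G>" for G
    using assms(6) that by (auto simp: graph_family_def)
  have "\<exists>p. comm_complexity p = T * (2 * nat \<lfloor>B * c\<rfloor>) \<and>
    (\<forall>G\<in>\<G>. \<forall>x\<in>{0..<n} \<rightarrow>\<^sub>E UNIV.
      run p (party_view G x (verts G - R n \<eta>)) (party_view G x (verts G - L \<eta>))
       = (restrict (dist_outputs B P G x (coins_of n r) T) (L ((n + 1) div 2)),
          restrict (dist_outputs B P G x (coins_of n r) T) (R n ((n + 1) div 2))))" for r
    using assms T P
    by (intro deterministic_simulation[where k = k]) (auto simp: dist_solves_def coins_of_def)
  then obtain Q :: "('x, 'y) public_coin_protocol"
    where comm: "\<And>r. comm_complexity (Q r) = T * (2 * nat \<lfloor>B * c\<rfloor>)"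
      and run: "\<And>r G x. G \<in> \<G> \<Longrightarrow> x \<in> {0..<n} \<rightarrow>\<^sub>E UNIV \<Longrightarrow>
        run (Q r) (party_view G x (verts G - R n \<eta>)) (party_view G x (verts G - L \<eta>))
       = (restrict (dist_outputs B P G x (coins_of n r) T) (L ((n + 1) div 2)),
          restrict (dist_outputs B P G x (coins_of n r) T) (R n ((n + 1) div 2)))"
    by metis
  have "real (comm_complexity (Q r)) \<le> 2 * B * c * real T" for r
  proof -
    have "real (nat \<lfloor>B * c\<rfloor>) \<le> B * c"
      using assms by (intro of_nat_floor) simp
    then have "real T * (2 * real (nat \<lfloor>B * c\<rfloor>)) \<le> real T * (2 * (B * c))"
      by (intro mult_left_mono) auto
    then show ?thesis by (simp add: comm mult_ac)
  qed
  moreover have "eta_solves n \<eta> Q task \<epsilon> G" if G: "G \<in> \<G>" for G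
    unfolding eta_solves_def
  proof
    fix x :: "nat \<Rightarrow> 'x" assume x: "x \<in> verts G \<rightarrow>\<^sub>E UNIV"
    let ?out = "\<lambda>r. dist_outputs B P G x (coins_of n r) T"
    let ?E = "{\<omega> \<in> space (node_coins G). task G x (dist_outputs B P G x \<omega> T)}"
    have E: "?E \<in> sets (node_coins G)" "measure (node_coins G) ?E \<ge> 1 - \<epsilon>"
      using P[OF G] x by (auto simp: dist_solves_def holds_with_prob_def)
    have halves: "verts G = L ((n + 1) div 2) \<union> R n ((n + 1) div 2)"
    proof -
      have "{0..<h} \<union> {n - h..<n} = {0..<n}" if "h \<le> n" "n \<le> 2 * h" for h
        using that by auto
      from this[of "(n + 1) div 2"] show ?thesis
        using V[OF G] \<open>n > 0\<close> by (simp add: L_def R_def)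
    qed
    have out: "?out r \<in> verts G \<rightarrow>\<^sub>E UNIV" for r
      by (simp add: dist_outputs_def)
    \<comment> \<open>The two halves cover all nodes, so the outputs of the parties leave no freedom
      for \<open>y\<close>: it can only be the output vector of the distributed run.\<close>
    have "(\<exists>y\<in>verts G \<rightarrow>\<^sub>E UNIV. task G x y \<and> (\<forall>v\<in>L ((n + 1) div 2). y v = ?out r v)
        \<and> (\<forall>v\<in>R n ((n + 1) div 2). y v = ?out r v)) \<longleftrightarrow> task G x (?out r)" (is "?l \<longleftrightarrow> ?r") for r
    proof
      assume ?l
      then obtain y where y: "y \<in> verts G \<rightarrow>\<^sub>E UNIV" "task G x y" "\<forall>v\<in>verts G. y v = ?out r v"
        by (auto simp: halves)
      then have "y = ?out r" using out[of r] by (intro PiE_ext) auto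
      then show ?r using y by simp
    qed (use out in blast)
    then have "{r \<in> space public_coins.
        case run (Q r) (party_view G x (verts G - R n \<eta>)) (party_view G x (verts G - L \<eta>)) of
          (ya, yb) \<Rightarrow> \<exists>y \<in> verts G \<rightarrow>\<^sub>E UNIV. task G x y
            \<and> (\<forall>v \<in> L ((n + 1) div 2). y v = ya v) \<and> (\<forall>v \<in> R n ((n + 1) div 2). y v = yb v)}
        = coins_of n -` ?E \<inter> space public_coins"
      using run[OF G, of x] x V[OF G] measurable_space[OF measurable_coins_of[OF V[OF G]]] by auto
    moreover have "measure public_coins (coins_of n -` ?E \<inter> space public_coins)
        = measure (node_coins G) ?E"
      using measure_distr[OF measurable_coins_of[OF V[OF G]] E(1)] distr_coins_of[OF V[OF G]] by simp
    ultimately show "holds_with_prob public_coins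
        (\<lambda>r. case run (Q r) (party_view G x (verts G - R n \<eta>)) (party_view G x (verts G - L \<eta>)) of
          (ya, yb) \<Rightarrow> \<exists>y \<in> verts G \<rightarrow>\<^sub>E UNIV. task G x y
            \<and> (\<forall>v \<in> L ((n + 1) div 2). y v = ya v) \<and> (\<forall>v \<in> R n ((n + 1) div 2). y v = yb v))
        (1 - \<epsilon>)"
      using E measurable_sets[OF measurable_coins_of[OF V[OF G]] E(1)]
      by (simp add: holds_with_prob_def)
  qed
  ultimately show ?thesis by blast
qed

end
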